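(* Let $A\in\mathbb{R}_{\max}^{n\times n}$, $C\in\mathbb{R}_{\max}^{q\times n}$, and let $\mathcal{V}\subset(\mathbb{R}_{\max}^n)^2$ be a congruence. If $\mathcal{W}\subset(\mathbb{R}_{\max}^n)^2$ is a closed congruence, then $$\mathcal{W}\in\mathscr{L}(C,A,\mathcal{V})\iff \mathcal{W}^\top\in\mathscr{M}(A^t,C^t,\mathcal{V}^\top).$$ That is, $\mathcal{W}$ is a $(C,A)$-conditioned invariant congruence containing $\mathcal{V}$ if and only if $\mathcal{W}^\top$ is an $(A^t,C^t)$-controlled invariant semimodule contained in $\mathcal{V}^\top$.
   Context: Max-plus semiring: $\mathbb{R}_{\max}=\mathbb{R}\cup\{-\infty\}$ with addition $a\oplus b=\max(a,b)$ and multiplication $ab=a+b$; the zero is $\varepsilon=-\infty$. Operations extend to matrices as usual: $(E\oplus F)_{ij}=E_{ij}\oplus F_{ij}$, $(EF)_{ij}=\bigoplus_k E_{ik}F_{kj}$; $E^t$ is the transpose. Topology: $\mathbb{R}_{\max}$ has the metric $d(a,b)=|\exp(a)-\exp(b)|$, and $\mathbb{R}_{\max}^n$ the product topology. A semimodule is a (nonempty) subset of $\mathbb{R}_{\max}^n$ stable under all max-plus linear combinations $\lambda x\oplus\mu y$. A congruence on $\mathbb{R}_{\max}^n$ is an equivalence relation $\mathcal{W}\subset(\mathbb{R}_{\max}^n)^2$ which is also a subsemimodule of $(\mathbb{R}_{\max}^n)^2$. For a matrix $E$, $\operatorname{Im}E=\{Ex\}$ and $\ker E=\{(x,y): Ex=Ey\}$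 (a congruence). For a congruence $\mathcal{W}$, $A\mathcal{W}=\{(Ax,Ay):(x,y)\in\mathcal{W}\}$. For semimodules, $\mathcal{X}\oplus\mathcal{Y}=\{x\oplus y: x\in\mathcal{X},y\in\mathcal{Y}\}$. A congruence $\mathcal{W}$ is $(C,A)$-conditioned invariant if $A(\mathcal{W}\cap\ker C)\subset\mathcal{W}$. A semimodule $\mathcal{X}\subset\mathbb{R}_{\max}^n$ is $(A,B)$-controlled invariant (for $B\in\mathbb{R}_{\max}^{n\times q}$) if $A\mathcal{X}\subset\mathcal{X}\oplus\operatorname{Im}B$. $\mathscr{L}(C,A,\mathcal{V})$ is the set of all $(C,A)$-conditioned invariant congruences containing $\mathcal{V}$; $\mathscr{M}(A,B,\mathcal{K})$ is the set of all $(A,B)$-controlled invariant semimodules contained in the semimodule $\mathcal{K}$. Orthogonal of a congruence $\mathcal{W}$: the semimodule $\mathcal{W}^\top=\{z\in\mathbb{R}_{\max}^n: x^tz=y^tz\ \forall (x,y)\in\mathcal{W}\}$. *)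

theory Defs
  imports "HOL-Analysis.Analysis" "HOL-Library.Set_Algebras"
begin

text \<open>
  The max-plus semiring. Its semiring operations are installed in the standard type classes,
  so on \<open>rmax\<close> the symbol \<open>+\<close> is the maximum, \<open>*\<close> is the addition of reals, \<open>0\<close> is
  \<open>NegInf\<close> and \<open>1\<close> is \<open>Fin 0\<close>. The library operations on vectors and matrices (\<open>+\<close>, \<open>*s\<close>,
  \<open>*v\<close>, \<open>transpose\<close>) then are the max-plus ones.
\<close>

datatype rmax = NegInf | Fin real

instantiation rmax :: linorder
begin

fun less_eq_rmax :: "rmax \<Rightarrow> rmax \<Rightarrow> bool" where
  "less_eq_rmax NegInf b = True"
| "less_eq_rmax (Fin r) NegInf = False"
| "less_eq_rmax (Fin r) (Fin s) = (r \<le> s)"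

definition less_rmax :: "rmax \<Rightarrow> rmax \<Rightarrow> bool" where
  "less_rmax a b \<longleftrightarrow> a \<le> b \<and> \<not> b \<le> a"

instance
proof
  fix a b c :: rmax
  show "a < b \<longleftrightarrow> a \<le> b \<and> \<not> b \<le> a" by (rule less_rmax_def)
  show "a \<le> a" by (cases a) auto
  show "a \<le> b \<Longrightarrow> b \<le> c \<Longrightarrow> a \<le> c" by (cases a; cases b; cases c) auto
  show "a \<le> b \<Longrightarrow> b \<le> a \<Longrightarrow> a = b" by (cases a; cases b) auto
  show "a \<le> b \<or> b \<le> a" by (cases a; cases b) auto
qed

end

instantiation rmax :: "{zero, one, plus, times}"
begin

definition zero_rmax :: rmax where "0 = NegInf"

definition one_rmax :: rmax where "1 = Fin 0"

definition plus_rmax :: "rmax \<Rightarrow> rmax \<Rightarrow> rmax" where "(a::rmax) + b = max a b"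

fun times_rmax :: "rmax \<Rightarrow> rmax \<Rightarrow> rmax" where
  "times_rmax NegInf b = NegInf"
| "times_rmax (Fin r) NegInf = NegInf"
| "times_rmax (Fin r) (Fin s) = Fin (r + s)"

instance ..

end

instance rmax :: comm_semiring_1
proof
  fix a b c :: rmax
  show "a + b + c = a + (b + c)" by (simp add: plus_rmax_def max.assoc)
  show "a + b = b + a" by (simp add: plus_rmax_def max.commute)
  show "0 + a = a" by (cases a) (auto simp: plus_rmax_def zero_rmax_def max_def)
  show "a * b * c = a * (b * c)" by (cases a; cases b; cases c) auto
  show "a * b = b * a" by (cases a; cases b) auto
  show "1 * a = a" by (cases a) (auto simp: one_rmax_def)
  show "(a + b) * c = a * c + b * c"
    by (cases a; cases b; cases c) (auto simp: plus_rmax_def max_def)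
  show "0 * a = 0" by (simp add: zero_rmax_def)
  show "a * 0 = 0" by (cases a) (auto simp: zero_rmax_def)
  show "(0::rmax) \<noteq> 1" by (simp add: zero_rmax_def one_rmax_def)
qed

fun exp_rmax :: "rmax \<Rightarrow> real" where
  "exp_rmax NegInf = 0"
| "exp_rmax (Fin r) = exp r"

lemma exp_rmax_inject: "exp_rmax a = exp_rmax b \<longleftrightarrow> a = b"
  by (cases a; cases b) (auto simp: exp_not_eq_zero[symmetric])

text \<open>
  The library instances for \<open>^\<close> and \<open>\<times>\<close> turn this metric into the product topologies on
  vectors and on pairs of vectors.
\<close>

instantiation rmax :: metric_space
begin

definition dist_rmax :: "rmax \<Rightarrow> rmax \<Rightarrow> real" where
  "dist (a::rmax) b = \<bar>exp_rmax a - exp_rmax b\<bar>"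

definition uniformity_rmax :: "(rmax \<times> rmax) filter" where
  "(uniformity :: (rmax \<times> rmax) filter) = (INF e\<in>{0<..}. principal {(a::rmax, b). dist a b < e})"

definition open_rmax :: "rmax set \<Rightarrow> bool" where
  "open (U :: rmax set) \<longleftrightarrow> (\<forall>a\<in>U. eventually (\<lambda>(a', b). a' = a \<longrightarrow> b \<in> U) uniformity)"

instance
proof
  fix a b c :: rmax
  show "dist a b = 0 \<longleftrightarrow> a = b" by (simp add: dist_rmax_def exp_rmax_inject)
  show "dist a b \<le> dist a c + dist b c" by (simp add: dist_rmax_def)
qed (simp_all only: uniformity_rmax_def open_rmax_def)

end

definition semimodule :: "(rmax ^ 'n) set \<Rightarrow> bool" where
  "semimodule X \<longleftrightarrow> X \<noteq> {} \<and> (\<forall>x\<in>X. \<forall>y\<in>X. \<forall>l m. l *s x + m *s y \<in> X)"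

text \<open>Subsemimodules of the square, with componentwise operations.\<close>

definition semimodule2 :: "((rmax ^ 'n) \<times> (rmax ^ 'n)) set \<Rightarrow> bool" where
  "semimodule2 W \<longleftrightarrow> W \<noteq> {} \<and>
     (\<forall>(x, x')\<in>W. \<forall>(y, y')\<in>W. \<forall>l m. (l *s x + m *s y, l *s x' + m *s y') \<in> W)"

definition congruence :: "((rmax ^ 'n) \<times> (rmax ^ 'n)) set \<Rightarrow> bool" where
  "congruence W \<longleftrightarrow> equiv UNIV W \<and> semimodule2 W"

definition mat_image :: "rmax ^ 'q ^ 'n \<Rightarrow> (rmax ^ 'n) set" where
  "mat_image B = range (\<lambda>x. B *v x)"

definition mat_kernel :: "rmax ^ 'n ^ 'q \<Rightarrow> ((rmax ^ 'n) \<times> (rmax ^ 'n)) set" where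
  "mat_kernel C = {(x, y). C *v x = C *v y}"

definition conditioned_invariant ::
  "rmax ^ 'n ^ 'q \<Rightarrow> rmax ^ 'n ^ 'n \<Rightarrow> ((rmax ^ 'n) \<times> (rmax ^ 'n)) set \<Rightarrow> bool" where
  "conditioned_invariant C A W \<longleftrightarrow> (\<lambda>(x, y). (A *v x, A *v y)) ` (W \<inter> mat_kernel C) \<subseteq> W"

text \<open>The sum of sets below is the elementwise one.\<close>

definition controlled_invariant ::
  "rmax ^ 'n ^ 'n \<Rightarrow> rmax ^ 'q ^ 'n \<Rightarrow> (rmax ^ 'n) set \<Rightarrow> bool" where
  "controlled_invariant A B X \<longleftrightarrow> (\<lambda>x. A *v x) ` X \<subseteq> X + mat_image B"

definition conditioned_invariants ::
  "rmax ^ 'n ^ 'q \<Rightarrow> rmax ^ 'n ^ 'n \<Rightarrow> ((rmax ^ 'n) \<times> (rmax ^ 'n)) set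
    \<Rightarrow> ((rmax ^ 'n) \<times> (rmax ^ 'n)) set set" where
  "conditioned_invariants C A V = {W. congruence W \<and> conditioned_invariant C A W \<and> V \<subseteq> W}"

definition controlled_invariants ::
  "rmax ^ 'n ^ 'n \<Rightarrow> rmax ^ 'q ^ 'n \<Rightarrow> (rmax ^ 'n) set \<Rightarrow> (rmax ^ 'n) set set" where
  "controlled_invariants A B K = {X. semimodule X \<and> controlled_invariant A B X \<and> X \<subseteq> K}"

definition scalar_prod :: "rmax ^ 'n \<Rightarrow> rmax ^ 'n \<Rightarrow> rmax" where
  "scalar_prod x z = (\<Sum>i\<in>UNIV. x $ i * z $ i)"

definition orthogonal_of :: "((rmax ^ 'n) \<times> (rmax ^ 'n)) set \<Rightarrow> (rmax ^ 'n) set" where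
  "orthogonal_of W = {z. \<forall>(x, y)\<in>W. scalar_prod x z = scalar_prod y z}"

end

theory Submission imports Defs begin

text \<open>
  Both implications rest on two separation theorems, which say that closed congruences and closed
  semimodules are equal to their double orthogonals. A point outside a closed semimodule \<open>X\<close> is
  separated from it by a pair of linear forms obtained by residuation. For a closed congruence \<open>W\<close>,
  call \<open>u\<close> below \<open>v\<close> if \<open>(u + v, v) \<in> W\<close>; this preorder determines \<open>W\<close>. If \<open>x\<close> is not below \<open>y\<close>,
  then, for a slightly larger \<open>Y\<close> with no entry equal to \<open>0\<close>, the map sending \<open>u\<close> to the least \<open>l\<close>
  with \<open>u\<close> below \<open>l *s Y\<close> is a linear form in the orthogonal of \<open>W\<close> which separates \<open>x\<close> from \<open>y\<close>.

  With \<open>X\<close> the sum of the orthogonal of \<open>W\<close> and the image of the transpose of \<open>C\<close>, the orthogonal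
  of \<open>X\<close> is \<open>W \<inter> mat_kernel C\<close>. As \<open>X\<close> is closed, it is the orthogonal of \<open>W \<inter> mat_kernel C\<close>.
\<close>

section \<open>Order and topology of the max-plus semiring\<close>

lemma exp_rmax_nonneg [simp]: "0 \<le> exp_rmax a"
  by (cases a) auto

lemma exp_rmax_le_iff: "exp_rmax a \<le> exp_rmax b \<longleftrightarrow> a \<le> b"
  by (cases a; cases b) (auto simp: not_le)

lemma exp_rmax_zero [simp]: "exp_rmax 0 = 0"
  by (simp add: zero_rmax_def)

lemma exp_rmax_add: "exp_rmax (a + b) = max (exp_rmax a) (exp_rmax b)"
  by (auto simp: plus_rmax_def max_def exp_rmax_le_iff)

lemma exp_rmax_mult: "exp_rmax (a * b) = exp_rmax a * exp_rmax b"
  by (cases a; cases b) (auto simp: exp_add)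

lemma exp_rmax_surj:
  assumes "0 \<le> r"
  obtains a where "exp_rmax a = r"
proof (cases "r = 0")
  case True
  then show ?thesis using that[of 0] by simp
next
  case False
  then show ?thesis using that[of "Fin (ln r)"] assms by simp
qed

lemma exp_rmax_pos_iff: "0 < exp_rmax a \<longleftrightarrow> a \<noteq> 0"
  by (metis exp_rmax_inject exp_rmax_nonneg exp_rmax_zero less_le)

lemma rmax_zero_le [simp]: "0 \<le> (a :: rmax)"
  by (simp add: zero_rmax_def)

lemma rmax_add_self [simp]: "a + a = (a :: rmax)"
  by (simp add: plus_rmax_def)

lemma rmax_add_absorb: "a \<le> b \<longleftrightarrow> a + b = (b :: rmax)"
  by (auto simp: plus_rmax_def max_def)

lemma rmax_add_le_iff: "a + b \<le> c \<longleftrightarrow> a \<le> c \<and> b \<le> (c :: rmax)"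
  by (simp add: plus_rmax_def)

lemma rmax_sum_le_iff:
  fixes f :: "'a \<Rightarrow> rmax"
  assumes "finite S"
  shows "sum f S \<le> b \<longleftrightarrow> (\<forall>i\<in>S. f i \<le> b)"
  using assms by (induction S) (auto simp: rmax_add_le_iff)

lemma rmax_le_sum:
  fixes f :: "'a \<Rightarrow> rmax"
  assumes "finite S" "i \<in> S"
  shows "f i \<le> sum f S"
  using rmax_sum_le_iff[OF assms(1), of f "sum f S"] assms(2) by blast

lemma rmax_mult_left_mono: "a \<le> b \<Longrightarrow> c * a \<le> c * (b :: rmax)"
  by (simp add: mult_left_mono exp_rmax_mult flip: exp_rmax_le_iff)

lemma rmax_unit:
  assumes "a \<noteq> (0 :: rmax)"
  obtains b where "a * b = 1"
  using assms
proof (cases a)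
  case (Fin r)
  then show ?thesis using that[of "Fin (- r)"] by (simp add: one_rmax_def)
qed (simp add: zero_rmax_def)

text \<open>Multiplications by \<open>a\<close> and by \<open>b\<close> are monotone and inverse to
  each other. The residuation arguments below move invertible scalars across inequalities in this
  way.\<close>

lemma rmax_unit_mult_le_iff:
  fixes a b c d :: rmax
  assumes "a * b = 1"
  shows "b * c \<le> d \<longleftrightarrow> c \<le> a * d"
proof
  assume "b * c \<le> d"
  then have "a * (b * c) \<le> a * d" by (rule rmax_mult_left_mono)
  then show "c \<le> a * d" using assms by (simp flip: mult.assoc)
next
  assume "c \<le> a * d"
  then have "b * c \<le> b * (a * d)" by (rule rmax_mult_left_mono)
  then show "b * c \<le> d" using assms by (simp add: mult.commute flip: mult.assoc)
qed

text \<open>The metric is pulled back along \<open>exp_rmax\<close>, which is thus an isometry onto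
  the nonnegative reals. Limits are computed there, where the two operations become
  \<open>max\<close> and the ordinary product.\<close>

lemma tendsto_rmax_iff: "(f \<longlongrightarrow> a) F \<longleftrightarrow> ((\<lambda>x. exp_rmax (f x)) \<longlongrightarrow> exp_rmax a) F"
  by (simp add: tendsto_iff dist_rmax_def dist_real_def)

lemmas tendsto_exp_rmax [tendsto_intros] = tendsto_rmax_iff[THEN iffD1]

lemma continuous_on_exp_rmax [continuous_intros]:
  "continuous_on S f \<Longrightarrow> continuous_on S (\<lambda>x. exp_rmax (f x))"
  by (auto simp: continuous_on_def intro: tendsto_exp_rmax)

instance rmax :: topological_monoid_add
proof
  fix a b :: rmax
  show "LIM x (nhds a \<times>\<^sub>F nhds b). fst x + snd x :> nhds (a + b)"
    unfolding tendsto_rmax_iff exp_rmax_add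
    by (intro tendsto_intros filterlim_fst filterlim_snd)
qed

instance rmax :: topological_comm_monoid_add ..

instance rmax :: topological_semigroup_mult
proof
  fix a b :: rmax
  show "LIM x (nhds a \<times>\<^sub>F nhds b). fst x * snd x :> nhds (a * b)"
    unfolding tendsto_rmax_iff exp_rmax_mult
    by (intro tendsto_intros filterlim_fst filterlim_snd)
qed

instance rmax :: heine_borel
proof
  fix f :: "nat \<Rightarrow> rmax"
  assume "bounded (range f)"
  then obtain a e where ae: "\<And>n. dist a (f n) \<le> e"
    by (auto simp: bounded_def)
  have "bounded (range (\<lambda>n. exp_rmax (f n)))"
    using ae unfolding bounded_def dist_rmax_def dist_real_def by blast
  then obtain l r where r: "strict_mono (r :: nat \<Rightarrow> nat)"
    and l: "(\<lambda>n. exp_rmax (f (r n))) \<longlonglongrightarrow> l"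
    using bounded_imp_convergent_subsequence by (force simp: o_def)
  \<comment> \<open>The real limit stays in the range of \<open>exp_rmax\<close>: it is nonnegative,
    and \<open>NegInf\<close> supplies the value 0.\<close>
  have "0 \<le> l"
    by (rule LIMSEQ_le_const[OF l]) simp
  then obtain b where "exp_rmax b = l" by (rule exp_rmax_surj)
  then have "(f \<circ> r) \<longlonglongrightarrow> b"
    using l by (simp add: tendsto_rmax_iff)
  with r show "\<exists>l r. strict_mono (r :: nat \<Rightarrow> nat) \<and> (f \<circ> r) \<longlonglongrightarrow> l" by blast
qed

text \<open>As \<open>exp_rmax\<close> is nonnegative, initial segments are bounded, so the part of
  \<open>S\<close> up to one of its elements is compact and has a minimum. Such minima become the
  coefficients of a linear form.\<close>

lemma rmax_closed_least:
  fixes S :: "rmax set"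
  assumes "closed S" "S \<noteq> {}"
  obtains m where "m \<in> S" "\<And>a. a \<in> S \<Longrightarrow> m \<le> a"
proof -
  obtain s where s: "s \<in> S" using assms by blast
  define K where "K = S \<inter> {a. exp_rmax a \<le> exp_rmax s}"
  have "bounded {a. exp_rmax a \<le> exp_rmax s}"
    unfolding bounded_def
    by (rule exI[of _ 0], rule exI[of _ "exp_rmax s"]) (auto simp: dist_rmax_def)
  moreover have "closed {a. exp_rmax a \<le> exp_rmax s}"
    by (intro closed_Collect_le continuous_intros)
  ultimately have "compact K"
    using assms by (simp add: K_def compact_eq_bounded_closed bounded_Int closed_Int)
  moreover have "K \<noteq> {}" using s by (auto simp: K_def)
  ultimately have "\<exists>m\<in>K. \<forall>a\<in>K. exp_rmax m \<le> exp_rmax a"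
    by (intro continuous_attains_inf continuous_intros)
  then obtain m where m: "m \<in> K" "\<And>a. a \<in> K \<Longrightarrow> exp_rmax m \<le> exp_rmax a"
    by blast
  have "m \<le> a" if "a \<in> S" for a
    unfolding exp_rmax_le_iff[symmetric]
  proof (cases "exp_rmax a \<le> exp_rmax s")
    case True
    with that show "exp_rmax m \<le> exp_rmax a" by (intro m(2)) (simp add: K_def)
  next
    case False
    with m(1) show "exp_rmax m \<le> exp_rmax a" by (simp add: K_def)
  qed
  moreover have "m \<in> S" using m(1) by (simp add: K_def)
  ultimately show ?thesis using that by blast
qed

section \<open>Vectors and scalar products\<close>

lemma vec_add_absorb:
  fixes u v :: "rmax ^ 'n"
  shows "u + v = v \<longleftrightarrow> (\<forall>i. u $ i \<le> v $ i)"
  by (simp add: vec_eq_iff rmax_add_absorb)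

lemma vec_add_self [simp]: "u + u = (u :: rmax ^ 'n)"
  by (simp add: vec_eq_iff)

lemma vec_axis_expansion:
  fixes u :: "rmax ^ 'n"
  shows "u = (\<Sum>i\<in>UNIV. u $ i *s axis i 1)"
  by (simp add: vec_eq_iff axis_def if_distrib sum.If_cases cong: if_cong)

lemma scalar_prod_add_left: "scalar_prod (x + y) z = scalar_prod x z + scalar_prod y z"
  by (simp add: scalar_prod_def distrib_right sum.distrib)

lemma scalar_prod_scale_left: "scalar_prod (l *s x) z = l * scalar_prod x z"
  by (simp add: scalar_prod_def sum_distrib_left mult.assoc)

lemma scalar_prod_commute: "scalar_prod x z = scalar_prod z x"
  by (simp add: scalar_prod_def mult.commute)

lemma scalar_prod_add_right: "scalar_prod x (y + z) = scalar_prod x y + scalar_prod x z"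
  by (metis scalar_prod_add_left scalar_prod_commute)

lemma scalar_prod_scale_right: "scalar_prod x (l *s z) = l * scalar_prod x z"
  by (metis scalar_prod_scale_left scalar_prod_commute)

lemma scalar_prod_axis: "scalar_prod (axis j a) z = a * z $ j"
  by (simp add: scalar_prod_def axis_def if_distribR if_distrib[of "\<lambda>b. b * _"] cong: if_cong)

lemma scalar_prod_le_iff: "scalar_prod x z \<le> a \<longleftrightarrow> (\<forall>i. x $ i * z $ i \<le> a)"
  by (simp add: scalar_prod_def rmax_sum_le_iff)

lemma scalar_prod_transpose:
  fixes E :: "rmax ^ 'n ^ 'q"
  shows "scalar_prod (E *v x) z = scalar_prod x (transpose E *v z)"
  unfolding scalar_prod_def matrix_vector_mult_def transpose_def
  by (simp add: sum_distrib_left sum_distrib_right, subst sum.swap) (simp add: ac_simps)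

lemma scalar_prod_ext:
  assumes "\<And>u. scalar_prod x u = scalar_prod y u"
  shows "x = y"
proof -
  have "x $ i = y $ i" for i
    using assms[of "axis i 1"] by (simp add: scalar_prod_commute[of _ "axis _ _"] scalar_prod_axis)
  then show ?thesis by (simp add: vec_eq_iff)
qed

lemma continuous_on_scalar_prod [continuous_intros]:
  "continuous_on S f \<Longrightarrow> continuous_on S (\<lambda>z. scalar_prod x (f z))"
  unfolding scalar_prod_def by (intro continuous_intros)

lemma dist_vec_le:
  fixes u v :: "rmax ^ 'n"
  assumes "\<And>i. dist (u $ i) (v $ i) \<le> d"
  shows "dist u v \<le> real CARD('n) * d"
proof -
  have "dist u v \<le> (\<Sum>i\<in>UNIV. dist (u $ i) (v $ i))"
    unfolding dist_vec_def by (rule L2_set_le_sum) simp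
  also have "\<dots> \<le> (\<Sum>i\<in>(UNIV :: 'n set). d)"
    by (intro sum_mono assms)
  finally show ?thesis by simp
qed

section \<open>Separation from closed semimodules\<close>

lemma semimodule_zero: "semimodule X \<Longrightarrow> 0 \<in> X"
  unfolding semimodule_def by (metis vector_smult_lzero add_0 ex_in_conv)

lemma semimodule_add:
  assumes "semimodule X" "x \<in> X" "y \<in> X"
  shows "x + y \<in> X"
proof -
  have "1 *s x + 1 *s y \<in> X"
    using assms unfolding semimodule_def by blast
  then show ?thesis by simp
qed

lemma semimodule_scale:
  assumes "semimodule X" "x \<in> X"
  shows "l *s x \<in> X"
proof -
  have "l *s x + 0 *s x \<in> X"
    using assms unfolding semimodule_def by blast
  then show ?thesis by simp
qed

lemma semimodule_sum:
  assumes "semimodule X" "\<And>i. i \<in> S \<Longrightarrow> f i \<in> X"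
  shows "sum f S \<in> X"
  using assms(2)
  by (induction S rule: infinite_finite_induct)
    (auto intro: semimodule_zero semimodule_add assms(1))

text \<open>If for every \<open>j\<close> some point of \<open>X\<close> under \<open>Z\<close> had
  its entry \<open>j\<close> close to \<open>z $ j\<close>, the sum of these points, again in
  \<open>X\<close>, would be close to \<open>z\<close> in all coordinates at once. Enlarging
  \<open>z\<close> to \<open>Z\<close> makes all entries invertible.\<close>

lemma semimodule_box_gap:
  fixes X :: "(rmax ^ 'n) set"
  assumes "closed X" "semimodule X" "z \<notin> X"
  obtains Z :: "rmax ^ 'n" and t j where "\<And>i. z $ i \<le> Z $ i" "\<And>i. Z $ i \<noteq> 0"
    "t \<noteq> 0" "t < z $ j" "\<And>w. w \<in> X \<Longrightarrow> (\<And>i. w $ i \<le> Z $ i) \<Longrightarrow> w $ j \<le> t"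
proof -
  obtain e where e: "e > 0" "\<And>v. dist v z < e \<Longrightarrow> v \<notin> X"
    using assms(1,3) unfolding closed_def open_dist by auto
  \<comment> \<open>The extra 1 makes \<open>real CARD('n) * d\<close> strictly less than
    \<open>e\<close>.\<close>
  define d where "d = e / (real CARD('n) + 1)"
  have "(real CARD('n) + 1) * d = e"
    by (simp add: d_def)
  moreover have d: "d > 0"
    using e(1) by (simp add: d_def)
  ultimately have de: "real CARD('n) * d < e"
    by (simp add: distrib_right)
  have "\<exists>a. exp_rmax a = exp_rmax (z $ i) + d" for i
    by (rule exp_rmax_surj[of "exp_rmax (z $ i) + d"]) (use d in auto)
  then obtain Z0 where Z0: "\<And>i. exp_rmax (Z0 i) = exp_rmax (z $ i) + d" by metis
  define Z where "Z = (\<chi> i. Z0 i)"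
  have Z: "exp_rmax (Z $ i) = exp_rmax (z $ i) + d" for i
    by (simp add: Z_def Z0)
  have "\<exists>j. \<forall>w\<in>X. (\<forall>i. w $ i \<le> Z $ i) \<longrightarrow> exp_rmax (w $ j) \<le> exp_rmax (z $ j) - d"
  proof (rule ccontr)
    assume "\<not> ?thesis"
    then have "\<forall>j. \<exists>w. w \<in> X \<and> (\<forall>i. w $ i \<le> Z $ i) \<and> exp_rmax (z $ j) - d < exp_rmax (w $ j)"
      by (meson not_le)
    then obtain w where w: "\<And>j. w j \<in> X" "\<And>j i. w j $ i \<le> Z $ i"
      "\<And>j. exp_rmax (z $ j) - d < exp_rmax (w j $ j)"
      by metis
    define v where "v = (\<Sum>j\<in>UNIV. w j)"
    have "v \<in> X"
      unfolding v_def using assms(2) w(1) by (intro semimodule_sum)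
    have "dist (v $ i) (z $ i) \<le> d" for i
    proof -
      have "v $ i \<le> Z $ i"
        using w(2) by (simp add: v_def rmax_sum_le_iff)
      then have "exp_rmax (v $ i) \<le> exp_rmax (z $ i) + d"
        by (simp add: Z flip: exp_rmax_le_iff)
      moreover have "w i $ i \<le> v $ i"
        using rmax_le_sum[of UNIV i "\<lambda>k. w k $ i"] by (simp add: v_def)
      then have "exp_rmax (w i $ i) \<le> exp_rmax (v $ i)"
        by (simp add: exp_rmax_le_iff)
      ultimately show ?thesis
        using w(3)[of i] by (simp add: dist_rmax_def abs_le_iff)
    qed
    then have "dist v z < e"
      using de by (intro le_less_trans[OF dist_vec_le])
    with e \<open>v \<in> X\<close> show False by blast
  qed
  then obtain j where j:
    "\<And>w. w \<in> X \<Longrightarrow> (\<And>i. w $ i \<le> Z $ i) \<Longrightarrow> exp_rmax (w $ j) \<le> exp_rmax (z $ j) - d"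
    by blast
  \<comment> \<open>The vector 0 lies in \<open>X\<close> and under \<open>Z\<close>, so this bound
    is nonnegative. Subtracting only \<open>d / 2\<close> then keeps \<open>t\<close> nonzero, hence
    invertible, and still below \<open>z $ j\<close>.\<close>
  have "0 \<le> exp_rmax (z $ j) - d"
    using j[OF semimodule_zero[OF assms(2)]] by simp
  then have pos: "0 < exp_rmax (z $ j) - d / 2"
    using d by simp
  then obtain t where t: "exp_rmax t = exp_rmax (z $ j) - d / 2"
    using exp_rmax_surj by (metis less_imp_le)
  show ?thesis
  proof
    show "z $ i \<le> Z $ i" "Z $ i \<noteq> 0" for i
      using d Z[of i] exp_rmax_nonneg[of "z $ i"]
      by (auto simp add: add_nonneg_pos simp flip: exp_rmax_le_iff exp_rmax_pos_iff)
    show "t \<noteq> 0" using t pos by (simp flip: exp_rmax_pos_iff)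
    show "t < z $ j" using t d by (simp add: less_le_not_le flip: exp_rmax_le_iff)
    show "w $ j \<le> t" if "w \<in> X" "\<And>i. w $ i \<le> Z $ i" for w
      using j[OF that] t d by (simp flip: exp_rmax_le_iff)
  qed
qed

text \<open>With \<open>y\<close> the entrywise inverse of \<open>Z\<close>,
  \<open>scalar_prod y w\<close> is the least \<open>l\<close> such that \<open>w\<close> is
  entrywise at most \<open>l *s Z\<close>. On \<open>X\<close> the gap bounds
  \<open>s * w $ j\<close> by this form, so adding \<open>axis j s\<close> to \<open>y\<close>
  changes no value there, but it does at \<open>z\<close>.\<close>

theorem closed_semimodule_separation:
  fixes X :: "(rmax ^ 'n) set"
  assumes "closed X" "semimodule X" "z \<notin> X"
  obtains x y where "\<And>w. w \<in> X \<Longrightarrow> scalar_prod x w = scalar_prod y w"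
    "scalar_prod x z \<noteq> scalar_prod y z"
proof -
  obtain Z t j where Z: "\<And>i. z $ i \<le> Z $ i" "\<And>i. Z $ i \<noteq> 0" "t \<noteq> 0" "t < z $ j"
    and gap: "\<And>w. w \<in> X \<Longrightarrow> (\<And>i. w $ i \<le> Z $ i) \<Longrightarrow> w $ j \<le> t"
    using semimodule_box_gap[OF assms] by metis
  have "\<exists>b. Z $ i * b = 1" for i
    using rmax_unit[OF Z(2)] by blast
  then obtain y0 where y0: "\<And>i. Z $ i * y0 i = 1" by metis
  define y where "y = (\<chi> i. y0 i)"
  have y: "Z $ i * y $ i = 1" for i by (simp add: y_def y0)
  obtain s where s: "t * s = 1" using rmax_unit[OF Z(3)] .
  have form: "scalar_prod (axis j s + y) w = s * w $ j + scalar_prod y w" for w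
    by (simp add: scalar_prod_add_left scalar_prod_axis)
  have "s * w $ j \<le> scalar_prod y w" if w: "w \<in> X" for w
  proof (cases "scalar_prod y w = 0")
    \<comment> \<open>Here \<open>w\<close> cannot be normalised, but \<open>y $ j\<close> is
      invertible, so \<open>w $ j\<close> is 0.\<close>
    case True
    then have "y $ j * w $ j \<le> 0"
      using scalar_prod_le_iff[of y w 0] by simp
    then have "w $ j \<le> 0"
      by (subst (asm) rmax_unit_mult_le_iff[OF y]) simp
    then have "s * w $ j \<le> s * 0" by (rule rmax_mult_left_mono)
    then show ?thesis using True by simp
  next
    case False
    \<comment> \<open>Dividing \<open>w\<close> by the value of the form brings it under
      \<open>Z\<close>, where \<open>gap\<close> applies.\<close>
    then obtain m where m: "scalar_prod y w * m = 1" by (rule rmax_unit)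
    have "(m *s w) $ i \<le> Z $ i" for i
    proof -
      have "y $ i * w $ i \<le> scalar_prod y w"
        using scalar_prod_le_iff by blast
      then have "w $ i \<le> Z $ i * scalar_prod y w"
        by (simp add: rmax_unit_mult_le_iff[OF y])
      then show ?thesis
        by (simp add: rmax_unit_mult_le_iff[OF m] mult.commute)
    qed
    then have "(m *s w) $ j \<le> t"
      using w by (intro gap semimodule_scale assms(2))
    then have "w $ j \<le> scalar_prod y w * t"
      by (simp add: rmax_unit_mult_le_iff[OF m])
    then show ?thesis
      by (simp add: rmax_unit_mult_le_iff[OF s] mult.commute)
  qed
  then have "scalar_prod (axis j s + y) w = scalar_prod y w" if "w \<in> X" for w
    using that by (simp add: form rmax_add_absorb)
  moreover have "scalar_prod (axis j s + y) z \<noteq> scalar_prod y z"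
  proof
    assume "scalar_prod (axis j s + y) z = scalar_prod y z"
    then have "s * z $ j \<le> scalar_prod y z"
      by (simp add: form rmax_add_absorb)
    also have "\<dots> \<le> 1"
      using Z(1) by (simp add: scalar_prod_le_iff rmax_unit_mult_le_iff[OF y])
    finally have "z $ j \<le> t"
      by (simp add: rmax_unit_mult_le_iff[OF s])
    with Z(4) show False by simp
  qed
  ultimately show ?thesis using that by blast
qed

section \<open>Separation for closed congruences\<close>

lemma congruence_refl: "congruence W \<Longrightarrow> (x, x) \<in> W"
  by (auto simp: congruence_def equiv_def refl_on_def)

lemma congruence_sym: "congruence W \<Longrightarrow> (x, y) \<in> W \<Longrightarrow> (y, x) \<in> W"
  by (auto simp: congruence_def equiv_def dest: symD)

lemma congruence_trans: "congruence W \<Longrightarrow> (x, y) \<in> W \<Longrightarrow> (y, z) \<in> W \<Longrightarrow> (x, z) \<in> W"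
  unfolding congruence_def equiv_def by (blast dest: transD)

lemma congruence_comb:
  assumes "congruence W" "(x, x') \<in> W" "(y, y') \<in> W"
  shows "(l *s x + m *s y, l *s x' + m *s y') \<in> W"
  using assms unfolding congruence_def semimodule2_def by blast

lemma congruence_add:
  assumes "congruence W" "(x, x') \<in> W" "(y, y') \<in> W"
  shows "(x + y, x' + y') \<in> W"
  using congruence_comb[OF assms, of 1 1] by simp

lemma congruence_scale:
  assumes "congruence W" "(x, x') \<in> W"
  shows "(l *s x, l *s x') \<in> W"
  using congruence_comb[OF assms assms(2), of l 0] by simp

text \<open>For a congruence \<open>W\<close>, this is the natural order of the quotient by
  \<open>W\<close>, whose addition is idempotent, pulled back to vectors.\<close>

definition below :: "((rmax ^ 'n) \<times> (rmax ^ 'n)) set \<Rightarrow> rmax ^ 'n \<Rightarrow> rmax ^ 'n \<Rightarrow> bool" where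
  "below W u v \<longleftrightarrow> (u + v, v) \<in> W"

context
  fixes W :: "((rmax ^ 'n) \<times> (rmax ^ 'n)) set"
  assumes W: "congruence W"
begin

lemma below_if_le: "(\<And>i. u $ i \<le> v $ i) \<Longrightarrow> below W u v"
  using congruence_refl[OF W] vec_add_absorb[of u v] by (simp add: below_def)

text \<open>Modulo \<open>W\<close>, \<open>u + w\<close> equals \<open>u + (v + w)\<close>, then
  \<open>v + w\<close>, then \<open>w\<close>.\<close>

lemma below_trans:
  assumes "below W u v" "below W v w"
  shows "below W u w"
proof -
  have 1: "(u + v + w, v + w) \<in> W" "(v + w, w) \<in> W"
    using congruence_add[OF W _ congruence_refl[OF W], of "u + v" v w] assms
    by (auto simp: below_def)
  have "(u + (v + w), u + w) \<in> W"
    using congruence_add[OF W congruence_refl[OF W] 1(2)] by simp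
  with 1 show ?thesis
    unfolding below_def by (metis W congruence_trans congruence_sym add.assoc)
qed

lemma below_add:
  assumes "below W u w" "below W v w"
  shows "below W (u + v) w"
proof -
  have "(u + w + (v + w), w + w) \<in> W"
    using assms unfolding below_def by (rule congruence_add[OF W])
  moreover have "u + w + (v + w) = u + v + (w + w)"
    by (simp only: ac_simps)
  ultimately show ?thesis by (simp add: below_def)
qed

lemma below_sum:
  assumes "finite S" "\<And>i. i \<in> S \<Longrightarrow> below W (f i) w"
  shows "below W (sum f S) w"
  using assms by (induction S) (auto intro: below_add below_if_le)

lemma below_scale: "below W u v \<Longrightarrow> below W (l *s u) (l *s v)"
  unfolding below_def using congruence_scale[OF W, of "u + v" v l]
  by (simp add: vector_add_ldistrib)

lemma below_of_mem:
  assumes "(u, v) \<in> W"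
  shows "below W u v"
  using congruence_add[OF W assms congruence_refl[OF W, of v]] by (simp add: below_def)

lemma mem_iff_below: "(u, v) \<in> W \<longleftrightarrow> below W u v \<and> below W v u"
proof
  assume "(u, v) \<in> W"
  then show "below W u v \<and> below W v u"
    using below_of_mem congruence_sym[OF W] by blast
next
  assume "below W u v \<and> below W v u"
  then have "(u + v, v) \<in> W" "(u + v, u) \<in> W"
    by (simp_all add: below_def add.commute)
  then show "(u, v) \<in> W"
    using W congruence_sym congruence_trans by blast
qed

text \<open>The free vector \<open>c\<close> allows two uses: \<open>c = 0\<close> gives the scales
  \<open>l\<close> with \<open>a\<close> below \<open>l *s b\<close>; \<open>a = x + y\<close> and
  \<open>c = y\<close> give those with \<open>x\<close> below \<open>y + l *s b\<close>.\<close>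

lemma closed_scaled_pairs:
  assumes "closed W"
  shows "closed {l. (a + l *s b, c + l *s b) \<in> W}"
proof -
  have "continuous_on UNIV (\<lambda>l. (a + l *s b, c + l *s b))"
    unfolding plus_vec_def vector_scalar_mult_def by (intro continuous_intros)
  then have "closed ((\<lambda>l. (a + l *s b, c + l *s b)) -` W)"
    by (rule closed_vimage[OF assms])
  then show ?thesis by (simp add: vimage_def)
qed

text \<open>The coefficient \<open>z $ i\<close> is the least scale for \<open>axis i 1\<close>,
  attained because \<open>W\<close> is closed. Expanding \<open>u\<close> in the axes extends this
  to all \<open>u\<close>, as \<open>below\<close> is compatible with scaling and with sums on the
  left.\<close>

lemma least_scale_form:
  assumes "closed W" "\<And>i. Y $ i \<noteq> 0"
  obtains z where "\<And>u l. scalar_prod u z \<le> l \<longleftrightarrow> below W u (l *s Y)"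
proof -
  have "\<exists>m. below W (axis i 1) (m *s Y) \<and> (\<forall>a. below W (axis i 1) (a *s Y) \<longrightarrow> m \<le> a)" for i
  proof -
    let ?S = "{l. (axis i 1 + l *s Y, 0 + l *s Y) \<in> W}"
    \<comment> \<open>The inverse of \<open>Y $ i\<close> lifts entry \<open>i\<close> of
      \<open>l *s Y\<close> to 1, so some scale works.\<close>
    obtain l where "Y $ i * l = 1" using rmax_unit[OF assms(2)] .
    then have "below W (axis i 1) (l *s Y)"
      by (intro below_if_le) (auto simp: axis_def mult.commute)
    then have "?S \<noteq> {}" by (auto simp: below_def)
    then show ?thesis
      using rmax_closed_least[OF closed_scaled_pairs[OF assms(1), of "axis i 1" Y 0]]
      by (auto simp: below_def)
  qed
  then obtain z0 where z0: "\<And>i. below W (axis i 1) (z0 i *s Y)"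
    "\<And>i a. below W (axis i 1) (a *s Y) \<Longrightarrow> z0 i \<le> a"
    by metis
  define z where "z = (\<chi> i. z0 i)"
  have z: "below W (axis i 1) (z $ i *s Y)" "below W (axis i 1) (a *s Y) \<Longrightarrow> z $ i \<le> a" for i a
    using z0 by (auto simp: z_def)
  have "scalar_prod u z \<le> l \<longleftrightarrow> below W u (l *s Y)" for u l
  proof
    assume le: "scalar_prod u z \<le> l"
    have "below W (u $ i *s axis i 1) (l *s Y)" for i
    proof (rule below_trans)
      show "below W (u $ i *s axis i 1) (u $ i *s (z $ i *s Y))"
        by (rule below_scale[OF z(1)])
      have "u $ i * z $ i \<le> l"
        using le by (simp add: scalar_prod_le_iff)
      then have "u $ i * z $ i * Y $ k \<le> l * Y $ k" for k
        using rmax_mult_left_mono[of _ _ "Y $ k"] by (simp only: mult.commute[of _ "Y $ k"])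
      then show "below W (u $ i *s (z $ i *s Y)) (l *s Y)"
        by (intro below_if_le) (simp add: mult.assoc)
    qed
    then have "below W (\<Sum>i\<in>UNIV. u $ i *s axis i 1) (l *s Y)"
      by (intro below_sum) auto
    then show "below W u (l *s Y)" using vec_axis_expansion[of u] by simp
  next
    assume u: "below W u (l *s Y)"
    have "u $ i * z $ i \<le> l" for i
    proof (cases "u $ i = 0")
      case False
      \<comment> \<open>Scaled by the inverse of its entry \<open>i\<close>, \<open>u\<close>
        dominates \<open>axis i 1\<close>, so the minimality of \<open>z $ i\<close>
        applies.\<close>
      then obtain m where m: "u $ i * m = 1" by (rule rmax_unit)
      have "below W (axis i 1) (m *s u)"
        using m by (intro below_if_le) (auto simp: axis_def mult.commute)
      moreover have "below W (m *s u) ((m * l) *s Y)"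
        using below_scale[OF u, of m] by (simp add: vector_smult_assoc)
      ultimately have "z $ i \<le> m * l"
        using z(2) below_trans by blast
      then show ?thesis
        using m by (subst rmax_unit_mult_le_iff[of m]) (simp_all add: mult.commute)
    qed simp
    then show "scalar_prod u z \<le> l" by (simp add: scalar_prod_le_iff)
  qed
  then show ?thesis using that by blast
qed

lemma orthogonal_separates_not_below:
  assumes "closed W" "\<not> below W x y"
  obtains z where "z \<in> orthogonal_of W" "scalar_prod x z \<noteq> scalar_prod y z"
proof -
  let ?one = "\<chi> i. 1 :: rmax ^ 'n"
  let ?N = "{l. (x + y + l *s ?one, y + l *s ?one) \<in> W}"
  \<comment> \<open>At \<open>l = 0\<close> the condition in \<open>?N\<close> says that
    \<open>x\<close> is below \<open>y\<close>. As \<open>W\<close> is closed, its failure persists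
    for a small nonzero \<open>l\<close>, which makes all entries of \<open>Y\<close>
    nonzero.\<close>
  have "open (- ?N)"
    using closed_scaled_pairs[OF assms(1)] by (simp add: open_Compl)
  moreover have "0 \<in> - ?N"
    using assms(2) by (simp add: below_def)
  ultimately obtain e where e: "e > 0" "\<And>l. dist l 0 < e \<Longrightarrow> l \<in> - ?N"
    unfolding open_dist by blast
  obtain l where l: "exp_rmax l = e / 2"
    using e(1) exp_rmax_surj[of "e / 2"] by auto
  define Y where "Y = y + l *s ?one"
  have "l \<in> - ?N" using e l by (intro e(2)) (simp add: dist_rmax_def)
  then have notY: "\<not> below W x Y"
    by (simp add: below_def Y_def add.assoc)
  have "l \<noteq> 0" using e l by (simp flip: exp_rmax_pos_iff)
  then have "Y $ i \<noteq> 0" for i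
    by (simp add: Y_def exp_rmax_add less_max_iff_disj flip: exp_rmax_pos_iff)
  then obtain z where z: "\<And>u l. scalar_prod u z \<le> l \<longleftrightarrow> below W u (l *s Y)"
    using least_scale_form[OF assms(1)] by metis
  \<comment> \<open>Here \<open>u\<close> is below \<open>v\<close>, which is below
    \<open>scalar_prod v z *s Y\<close>. Symmetry of \<open>W\<close> then turns the inequality into
    equality.\<close>
  have "scalar_prod u z \<le> scalar_prod v z" if "(u, v) \<in> W" for u v
  proof -
    have "below W v (scalar_prod v z *s Y)" by (simp flip: z)
    then show ?thesis
      using that z below_of_mem below_trans by blast
  qed
  then have "z \<in> orthogonal_of W"
    using congruence_sym[OF W] by (auto simp: orthogonal_of_def intro!: antisym)
  \<comment> \<open>The threshold is 1 because \<open>1 *s Y = Y\<close>: \<open>x\<close> is not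
    below \<open>Y\<close>, while \<open>y\<close> is.\<close>
  moreover have "\<not> scalar_prod x z \<le> 1"
    using notY by (simp add: z)
  moreover have "scalar_prod y z \<le> 1"
    unfolding z by (rule below_if_le) (simp add: Y_def plus_rmax_def)
  ultimately show ?thesis using that by metis
qed

theorem closed_congruence_separation:
  assumes "closed W" "(x, y) \<notin> W"
  obtains z where "z \<in> orthogonal_of W" "scalar_prod x z \<noteq> scalar_prod y z"
  using assms(2) orthogonal_separates_not_below[OF assms(1)] unfolding mem_iff_below by metis

end

section \<open>Orthogonals and the duality\<close>

lemma orthogonal_ofD: "z \<in> orthogonal_of W \<Longrightarrow> (x, y) \<in> W \<Longrightarrow> scalar_prod x z = scalar_prod y z"
  by (auto simp: orthogonal_of_def)

lemma orthogonal_of_antimono: "V \<subseteq> W \<Longrightarrow> orthogonal_of W \<subseteq> orthogonal_of V"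
  by (auto simp: orthogonal_of_def)

lemma semimodule_orthogonal_of: "semimodule (orthogonal_of W)"
proof -
  have "0 \<in> orthogonal_of W"
    by (simp add: orthogonal_of_def scalar_prod_def)
  moreover have "l *s x + m *s y \<in> orthogonal_of W"
    if "x \<in> orthogonal_of W" "y \<in> orthogonal_of W" for l m x y
    unfolding orthogonal_of_def
    by (auto simp: scalar_prod_add_right scalar_prod_scale_right
        orthogonal_ofD[OF that(1)] orthogonal_ofD[OF that(2)])
  ultimately show ?thesis unfolding semimodule_def by blast
qed

lemma closed_orthogonal_of: "closed (orthogonal_of W)"
proof -
  have "orthogonal_of W = (\<Inter>(x, y)\<in>W. {z. exp_rmax (scalar_prod x z) = exp_rmax (scalar_prod y z)})"
    by (auto simp: orthogonal_of_def exp_rmax_inject)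
  then show ?thesis
    by (auto intro!: closed_INT closed_Collect_eq continuous_intros)
qed

section \<open>Closedness of the sum of a closed set and the image of a matrix\<close>

lemma compact_rmax_box:
  fixes b :: "'n::finite \<Rightarrow> real"
  shows "compact {u :: rmax ^ 'n. \<forall>i. exp_rmax (u $ i) \<le> b i}"
proof -
  have "bounded {u :: rmax ^ 'n. \<forall>i. exp_rmax (u $ i) \<le> b i}"
    unfolding bounded_def
  proof (intro exI ballI)
    fix u :: "rmax ^ 'n"
    assume "u \<in> {u. \<forall>i. exp_rmax (u $ i) \<le> b i}"
    then have u: "exp_rmax (u $ i) \<le> b i" for i by simp
    have "dist (0 $ i) (u $ i) \<le> (\<Sum>i\<in>UNIV. b i)" for i
    proof -
      have "dist (0 $ i) (u $ i) \<le> b i" using u[of i] by (simp add: dist_rmax_def)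
      also have "\<dots> \<le> (\<Sum>i\<in>UNIV. b i)"
        by (rule member_le_sum) (auto intro: order_trans[OF exp_rmax_nonneg u])
      finally show ?thesis .
    qed
    then show "dist 0 u \<le> real CARD('n) * (\<Sum>i\<in>UNIV. b i)" by (rule dist_vec_le)
  qed
  moreover have "closed {u :: rmax ^ 'n. \<forall>i. exp_rmax (u $ i) \<le> b i}"
    by (intro closed_Collect_all closed_Collect_le continuous_intros)
  ultimately show ?thesis by (simp add: compact_eq_bounded_closed)
qed

text \<open>Entries of \<open>u\<close> at zero columns of \<open>B\<close> do not matter and are reset to \<open>0\<close>; the other ones
  are bounded in terms of \<open>B *v u\<close>. Zero entries of \<open>B\<close> contribute nothing to the bound, as \<open>x / 0 = 0\<close>.\<close>

lemma bounded_mat_preimage: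
  fixes B :: "rmax ^ 'q ^ 'n" and u :: "rmax ^ 'q"
  assumes "\<And>i. exp_rmax ((B *v u) $ i) \<le> b i"
  obtains u' where "B *v u' = B *v u"
    "\<And>j. exp_rmax (u' $ j) \<le> (\<Sum>i\<in>UNIV. b i / exp_rmax (B $ i $ j))"
proof
  define u' where "u' = (\<chi> j. if \<forall>i. B $ i $ j = 0 then 0 else u $ j)"
  show "B *v u' = B *v u"
    by (auto simp: vec_eq_iff matrix_vector_mult_def u'_def intro!: sum.cong)
  show "exp_rmax (u' $ j) \<le> (\<Sum>i\<in>UNIV. b i / exp_rmax (B $ i $ j))" for j
  proof -
    have b: "0 \<le> b i" for i
      using assms order_trans[OF exp_rmax_nonneg] by blast
    show ?thesis
    proof (cases "\<forall>i. B $ i $ j = 0")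
      case True
      then show ?thesis using b by (simp add: u'_def sum_nonneg)
    next
      case False
      then obtain i where i: "B $ i $ j \<noteq> 0" by blast
      have "B $ i $ j * u $ j \<le> (B *v u) $ i"
        unfolding matrix_vector_mult_def using rmax_le_sum[of UNIV j "\<lambda>j. B $ i $ j * u $ j"] by simp
      then have "exp_rmax (B $ i $ j) * exp_rmax (u $ j) \<le> b i"
        using assms[of i] order_trans by (fastforce simp flip: exp_rmax_mult exp_rmax_le_iff)
      then have "exp_rmax (u $ j) \<le> b i / exp_rmax (B $ i $ j)"
        using i by (simp add: field_simps exp_rmax_pos_iff)
      also have "\<dots> \<le> (\<Sum>i\<in>UNIV. b i / exp_rmax (B $ i $ j))"
        by (rule member_le_sum) (use b in auto)
      finally show ?thesis using False by (simp add: u'_def)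
    qed
  qed
qed

text \<open>Max-plus sums do not cancel: a bound on a sum bounds both summands. Near a limit point,
  only a compact part of \<open>X\<close> and a compact set of arguments of \<open>B\<close> matter,
  and their continuous image is closed.\<close>

lemma closed_plus_mat_image:
  fixes X :: "(rmax ^ 'n) set" and B :: "rmax ^ 'q ^ 'n"
  assumes "closed X"
  shows "closed (X + mat_image B)"
proof -
  have "a \<in> X + mat_image B" if a: "a \<in> closure (X + mat_image B)" for a
  proof -
    \<comment> \<open>Adding 1 makes \<open>a\<close> an interior point of the box.\<close>
    define b where "b i = exp_rmax (a $ i) + 1" for i
    define U where "U = (\<Inter>i. {v :: rmax ^ 'n. exp_rmax (v $ i) < b i})"
    define P where "P = X \<inter> {x. \<forall>i. exp_rmax (x $ i) \<le> b i}"
    define Q where "Q = {u :: rmax ^ 'q. \<forall>j. exp_rmax (u $ j) \<le> (\<Sum>i\<in>UNIV. b i / exp_rmax (B $ i $ j))}"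
    define K where "K = (\<lambda>(x, u). x + B *v u) ` (P \<times> Q)"
    have "open U"
      unfolding U_def by (intro open_INT finite ballI open_Collect_less continuous_intros)
    moreover have "a \<in> U" by (simp add: U_def b_def)
    ultimately have "a \<in> closure (U \<inter> (X + mat_image B))"
      using a open_Int_closure_subset by blast
    moreover have "U \<inter> (X + mat_image B) \<subseteq> K"
    proof
      fix v assume "v \<in> U \<inter> (X + mat_image B)"
      then obtain x u where v: "v = x + B *v u" "x \<in> X" "v \<in> U"
        by (auto simp: mat_image_def elim!: set_plus_elim)
      then have bd: "exp_rmax (x $ i) \<le> b i" "exp_rmax ((B *v u) $ i) \<le> b i" for i
        by (auto simp: U_def exp_rmax_add less_imp_le)
      obtain u' where "B *v u' = B *v u" "u' \<in> Q"
        using bounded_mat_preimage[of B u b, OF bd(2)] unfolding Q_def by blast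
      moreover have "x \<in> P"
        using v(2) bd(1) by (simp add: P_def)
      ultimately show "v \<in> K"
        unfolding K_def by (intro image_eqI[of _ _ "(x, u')"]) (simp_all add: v(1))
    qed
    moreover have "compact K"
      unfolding K_def
    proof (rule compact_continuous_image)
      show "continuous_on (P \<times> Q) (\<lambda>(x, u). x + B *v u)"
        unfolding plus_vec_def matrix_vector_mult_def case_prod_unfold by (auto intro!: continuous_intros)
      show "compact (P \<times> Q)"
        unfolding P_def Q_def
        by (intro compact_Times closed_Int_compact assms compact_rmax_box)
    qed
    ultimately have "a \<in> K"
      by (meson closure_minimal compact_imp_closed subsetD)
    then show ?thesis
      unfolding K_def P_def mat_image_def by (auto intro!: set_plus_intro)
  qed
  then show ?thesis by (metis closure_subset_eq subsetI)
qed

section \<open>Sums of semimodules and the duality\<close>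

lemma semimodule_mat_image: "semimodule (mat_image B)"
proof -
  have "l *s (B *v u) + m *s (B *v v) = B *v (l *s u + m *s v)" for l m u v
    by (simp add: vec_eq_iff matrix_vector_mult_def sum_distrib_left sum.distrib
        distrib_left mult.left_commute)
  then show ?thesis by (auto simp: semimodule_def mat_image_def)
qed

lemma semimodule_plus:
  assumes "semimodule X" "semimodule Y"
  shows "semimodule (X + Y)"
proof -
  have "l *s (x + y) + m *s (x' + y') \<in> X + Y"
    if "x \<in> X" "y \<in> Y" "x' \<in> X" "y' \<in> Y" for l m x y x' y'
  proof -
    have "l *s (x + y) + m *s (x' + y') = (l *s x + m *s x') + (l *s y + m *s y')"
      by (simp add: vector_add_ldistrib ac_simps)
    then show ?thesis
      using that assms by (simp add: set_plus_intro semimodule_add semimodule_scale)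
  qed
  moreover have "0 + 0 \<in> X + Y"
    using assms by (intro set_plus_intro semimodule_zero)
  ultimately show ?thesis
    unfolding semimodule_def by (blast elim!: set_plus_elim)
qed

text \<open>A point outside the sum is separated from it by a pair \<open>(x, y)\<close>. Agreement
  on the orthogonal of \<open>W\<close> puts the pair in \<open>W\<close>; agreement on the image of
  \<open>transpose C\<close> puts it in the kernel of \<open>C\<close>.\<close>

lemma orthogonal_of_Int_kernel:
  fixes C :: "rmax ^ 'n ^ 'q"
  assumes "congruence W" "closed W"
  shows "orthogonal_of (W \<inter> mat_kernel C) \<subseteq> orthogonal_of W + mat_image (transpose C)"
    (is "_ \<subseteq> ?X")
proof (rule subsetI, rule ccontr)
  fix z assume z: "z \<in> orthogonal_of (W \<inter> mat_kernel C)" "z \<notin> ?X"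
  have "closed ?X" "semimodule ?X"
    by (simp_all add: closed_plus_mat_image closed_orthogonal_of semimodule_plus
        semimodule_orthogonal_of semimodule_mat_image)
  then obtain x y where xy: "\<And>w. w \<in> ?X \<Longrightarrow> scalar_prod x w = scalar_prod y w"
    "scalar_prod x z \<noteq> scalar_prod y z"
    using closed_semimodule_separation z(2) by metis
  have "scalar_prod x w = scalar_prod y w" if "w \<in> orthogonal_of W" for w
    using xy(1)[OF set_plus_intro[OF that semimodule_zero[OF semimodule_mat_image]]] by simp
  then have "(x, y) \<in> W"
    using closed_congruence_separation[OF assms] by metis
  moreover have "scalar_prod (C *v x) u = scalar_prod (C *v y) u" for u
    using xy(1)[OF set_plus_intro[OF semimodule_zero[OF semimodule_orthogonal_of]],
        of "transpose C *v u"]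
    by (simp add: scalar_prod_transpose mat_image_def)
  then have "C *v x = C *v y" by (rule scalar_prod_ext)
  ultimately have "(x, y) \<in> W \<inter> mat_kernel C"
    by (simp add: mat_kernel_def)
  with z(1) xy(2) show False by (blast dest: orthogonal_ofD)
qed

theorem theorem2:
  fixes A :: "rmax ^ 'n ^ 'n" and C :: "rmax ^ 'n ^ 'q"
    and V W :: "((rmax ^ 'n) \<times> (rmax ^ 'n)) set"
  assumes "congruence V"
    and "congruence W" and "closed W"
  shows "W \<in> conditioned_invariants C A V \<longleftrightarrow>
    orthogonal_of W \<in> controlled_invariants (transpose A) (transpose C) (orthogonal_of V)"
proof
  assume "W \<in> conditioned_invariants C A V"
  then have inv: "\<And>x y. (x, y) \<in> W \<inter> mat_kernel C \<Longrightarrow> (A *v x, A *v y) \<in> W"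
    and VW: "V \<subseteq> W"
    by (auto simp: conditioned_invariants_def conditioned_invariant_def)
  \<comment> \<open>Transposition turns the invariance of \<open>W\<close> into orthogonality of
    \<open>transpose A *v z\<close> to \<open>W \<inter> mat_kernel C\<close>;
    \<open>orthogonal_of_Int_kernel\<close> then splits this vector.\<close>
  have "transpose A *v z \<in> orthogonal_of (W \<inter> mat_kernel C)" if "z \<in> orthogonal_of W" for z
  proof -
    have "scalar_prod x (transpose A *v z) = scalar_prod y (transpose A *v z)"
      if "(x, y) \<in> W \<inter> mat_kernel C" for x y
      using orthogonal_ofD[OF \<open>z \<in> orthogonal_of W\<close> inv[OF that]]
      by (simp add: scalar_prod_transpose)
    then show ?thesis unfolding orthogonal_of_def by blast
  qed
  then have "controlled_invariant (transpose A) (transpose C) (orthogonal_of W)"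
    using orthogonal_of_Int_kernel[OF assms(2,3)] unfolding controlled_invariant_def by blast
  then show "orthogonal_of W \<in> controlled_invariants (transpose A) (transpose C) (orthogonal_of V)"
    using VW by (simp add: controlled_invariants_def semimodule_orthogonal_of orthogonal_of_antimono)
next
  assume "orthogonal_of W \<in> controlled_invariants (transpose A) (transpose C) (orthogonal_of V)"
  then have inv: "transpose A *v z \<in> orthogonal_of W + mat_image (transpose C)"
    and WV: "z \<in> orthogonal_of V" if "z \<in> orthogonal_of W" for z
    using that by (auto simp: controlled_invariants_def controlled_invariant_def)
  \<comment> \<open>This is the nontrivial half of the equality of \<open>W\<close> with its double
    orthogonal.\<close>
  have dual: "(x, y) \<in> W"
    if "\<And>z. z \<in> orthogonal_of W \<Longrightarrow> scalar_prod x z = scalar_prod y z" for x y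
    using closed_congruence_separation[OF assms(2,3)] that by metis
  have "V \<subseteq> W"
    by (intro subrelI dual) (blast dest: WV orthogonal_ofD)
  moreover have "(A *v x, A *v y) \<in> W" if xy: "(x, y) \<in> W" "C *v x = C *v y" for x y
  proof (rule dual)
    fix z assume "z \<in> orthogonal_of W"
    then obtain w u where wu: "transpose A *v z = w + transpose C *v u" "w \<in> orthogonal_of W"
      using inv unfolding mat_image_def by (blast elim: set_plus_elim)
    \<comment> \<open>The part \<open>w\<close> does not distinguish \<open>x\<close> from
      \<open>y\<close> because \<open>(x, y) \<in> W\<close>, the other part because
      \<open>C *v x = C *v y\<close>.\<close>
    then show "scalar_prod (A *v x) z = scalar_prod (A *v y) z"
      by (simp only: scalar_prod_transpose[of A] wu(1) scalar_prod_add_right xy(2)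
          orthogonal_ofD[OF wu(2) xy(1)] flip: scalar_prod_transpose[of C])
  qed
  ultimately show "W \<in> conditioned_invariants C A V"
    using assms(2)
    by (auto simp: conditioned_invariants_def conditioned_invariant_def mat_kernel_def)
qed

end
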